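(* Let $A_k=\{a_1,\dots,a_k\}$ with $1=a_1<a_2<\dots<a_k$ integers, and let $h_0$ be the smallest positive integer $h$ with $n(h)\ge a_k$. Then there exists an integer $h_1\ge h_0-1$ such that $n(h+1)=n(h)+a_k$ for all integers $h\ge h_1$.
   Context: For an integer $h\ge 0$, an integer $x\ge 0$ has an $h$-representation if $x=\sum_{i=1}^k c_ia_i$ with nonnegative integers $c_i$ and $\sum_i c_i\le h$. The $h$-range $n(h)$ is the largest integer $n$ such that every integer $0\le x\le n$ has an $h$-representation. *)

theory Defs
  imports Main
begin

definition h_representation :: "(nat \<Rightarrow> nat) \<Rightarrow> nat \<Rightarrow> nat \<Rightarrow> nat \<Rightarrow> bool" where
  "h_representation a k h x \<longleftrightarrow>
     (\<exists>c :: nat \<Rightarrow> nat. x = (\<Sum>i=1..k. c i * a i) \<and> (\<Sum>i=1..k. c i) \<le> h)"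

definition h_range :: "(nat \<Rightarrow> nat) \<Rightarrow> nat \<Rightarrow> nat \<Rightarrow> nat" where
  "h_range a k h = (GREATEST n. \<forall>x\<le>n. h_representation a k h x)"

definition h_zero :: "(nat \<Rightarrow> nat) \<Rightarrow> nat \<Rightarrow> nat" where
  "h_zero a k = (LEAST h. h > 0 \<and> h_range a k h \<ge> a k)"

text \<open>For integers \<open>1 = a 1 < \<dots> < a k\<close> the operators \<open>GREATEST\<close> and \<open>LEAST\<close>
  above pick out genuine elements: see \<open>h_range_eq_iff\<close> and \<open>h_zero_eq_iff\<close>.\<close>

lemma h_representation_le:
  assumes "strict_mono_on {1..k} a" "h_representation a k h x"
  shows "x \<le> h * a k"
proof -
  obtain c where c: "x = (\<Sum>i=1..k. c i * a i)" "(\<Sum>i=1..k. c i) \<le> h"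
    using assms(2) by (auto simp: h_representation_def)
  have "a i \<le> a k" if "i \<in> {1..k}" for i
    using assms(1) that by (cases "i = k") (auto simp: strict_mono_on_def intro!: less_imp_le)
  then have "x \<le> (\<Sum>i=1..k. c i * a k)"
    unfolding c(1) by (intro sum_mono mult_le_mono) auto
  also have "\<dots> = (\<Sum>i=1..k. c i) * a k"
    by (simp add: sum_distrib_right)
  also have "\<dots> \<le> h * a k"
    using c(2) by (rule mult_le_mono1)
  finally show ?thesis .
qed

lemma h_range_eq_iff:
  assumes "strict_mono_on {1..k} a"
  shows "h_range a k h = n \<longleftrightarrow>
    (\<forall>x\<le>n. h_representation a k h x) \<and>
    (\<forall>m. (\<forall>x\<le>m. h_representation a k h x) \<longrightarrow> m \<le> n)"
proof -
  let ?P = "\<lambda>n. \<forall>x\<le>n. h_representation a k h x"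
  have bound: "?P m \<Longrightarrow> m \<le> h * a k" for m
    using h_representation_le[OF assms] by blast
  have "?P 0"
    by (auto simp: h_representation_def intro!: exI[of _ "\<lambda>_. 0"])
  then have "?P (h_range a k h)"
    unfolding h_range_def using bound by (rule GreatestI_nat)
  moreover have "m \<le> h_range a k h" if "?P m" for m
    unfolding h_range_def using that bound by (rule Greatest_le_nat)
  ultimately show ?thesis
    by (metis order_antisym)
qed

lemma h_zero_eq_iff:
  assumes "k \<ge> 1" "a 1 = 1" "strict_mono_on {1..k} a"
  shows "h_zero a k = h \<longleftrightarrow>
    h > 0 \<and> h_range a k h \<ge> a k \<and> (\<forall>g>0. h_range a k g \<ge> a k \<longrightarrow> h \<le> g)"
proof -
  let ?Q = "\<lambda>h. h > 0 \<and> h_range a k h \<ge> a k"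
  have "h_representation a k (a k) x" if "x \<le> a k" for x
    unfolding h_representation_def using assms(1,2) that
    by (intro exI[of _ "\<lambda>i. if i = 1 then x else 0"]) (simp add: if_distribR if_distrib[of "\<lambda>t. t * _"] cong: if_cong)
  then have "a k \<le> h_range a k (a k)"
    using h_range_eq_iff[OF assms(3)] by blast
  moreover have "a k > 0"
    using assms strict_mono_onD[OF assms(3), of 1 k] by (cases "k = 1") auto
  ultimately have "?Q (a k)" by blast
  then have "?Q (h_zero a k)"
    unfolding h_zero_def by (rule LeastI)
  moreover have "h_zero a k \<le> g" if "?Q g" for g
    unfolding h_zero_def using that by (rule Least_le)
  ultimately show ?thesis
    by (metis order_antisym)
qed

end

theory Submission
  imports Defs
begin

text \<open>An \<open>h\<close>-representation reaches at most \<open>h * a k\<close>, so the defect \<open>h * a k - n(h)\<close> is a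
  natural number. Once \<open>n(h) \<ge> a k\<close>, adding one copy of \<open>a k\<close> to representations gives
  \<open>n(h + 1) \<ge> n(h) + a k\<close>, i.e. the defect does not grow. A non-increasing sequence of natural
  numbers is eventually constant.\<close>

lemma antimono_on_atLeast_eventually_constant:
  fixes f :: "'a::preorder \<Rightarrow> 'b::wellorder"
  assumes "antimono_on {m..} f"
  obtains n where "n \<ge> m" "\<And>i. i \<ge> n \<Longrightarrow> f i = f n"
proof -
  define y where "y = (LEAST y. y \<in> f ` {m..})"
  have "y \<in> f ` {m..}"
    unfolding y_def by (rule LeastI[of _ "f m"]) simp
  then obtain n where n: "n \<ge> m" "f n = y"
    by auto
  have "f i = f n" if "i \<ge> n" for i
  proof (rule antisym)
    have "i \<ge> m"
      using n(1) that by (rule order_trans)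
    then show "f i \<le> f n"
      using n(1) that by (intro monotone_onD[OF assms]) auto
    show "f n \<le> f i"
      unfolding n(2) y_def using \<open>i \<ge> m\<close> by (intro Least_le imageI) simp
  qed
  with n(1) show thesis
    by (rule that)
qed

lemma h_representation_mono:
  assumes "h_representation a k h x" "h \<le> g"
  shows "h_representation a k g x"
  using assms by (auto simp: h_representation_def intro: order_trans)

lemma h_representation_add:
  assumes "h_representation a k h x" "h_representation a k g y"
  shows "h_representation a k (h + g) (x + y)"
proof -
  obtain c d where "x = (\<Sum>i=1..k. c i * a i)" "(\<Sum>i=1..k. c i) \<le> h"
    and "y = (\<Sum>i=1..k. d i * a i)" "(\<Sum>i=1..k. d i) \<le> g"
    using assms by (auto simp: h_representation_def)
  then show ?thesis
    unfolding h_representation_def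
    by (intro exI[of _ "\<lambda>i. c i + d i"]) (simp add: sum.distrib distrib_right)
qed

lemma h_representation_basis:
  assumes "i \<in> {1..k}"
  shows "h_representation a k 1 (a i)"
  unfolding h_representation_def using assms
  by (intro exI[of _ "\<lambda>j. of_bool (j = i)"])
    (simp add: of_bool_def if_distrib[of "\<lambda>t. t * _"] cong: if_cong)

lemma le_h_range_iff:
  assumes "strict_mono_on {1..k} a"
  shows "n \<le> h_range a k h \<longleftrightarrow> (\<forall>x\<le>n. h_representation a k h x)"
  using h_range_eq_iff[OF assms, of h] order_trans by blast

lemma h_range_mono:
  assumes "strict_mono_on {1..k} a" "h \<le> g"
  shows "h_range a k h \<le> h_range a k g"
  using assms le_h_range_iff[OF assms(1)] by (blast intro: h_representation_mono)

lemma h_range_le: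
  assumes "strict_mono_on {1..k} a"
  shows "h_range a k h \<le> h * a k"
  using assms le_h_range_iff[OF assms] by (blast intro: h_representation_le)

lemma h_range_add_le:
  assumes "strict_mono_on {1..k} a" "h_representation a k g y" "y \<le> Suc (h_range a k h)"
  shows "h_range a k h + y \<le> h_range a k (h + g)"
  unfolding le_h_range_iff[OF assms(1)]
proof (intro allI impI)
  fix x assume x: "x \<le> h_range a k h + y"
  have represented: "h_representation a k h z" if "z \<le> h_range a k h" for z
    using that le_h_range_iff[OF assms(1)] by blast
  show "h_representation a k (h + g) x"
  proof (cases "y \<le> x")
    case True
    with x have "h_representation a k h (x - y)"
      by (intro represented) simp
    from h_representation_add[OF this assms(2)] True show ?thesis
      by simp
  next
    case False
    with assms(3) have "h_representation a k h x"
      by (intro represented) simp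
    then show ?thesis
      by (rule h_representation_mono) simp
  qed
qed

lemma h_range_ge_if_h_zero_le:
  assumes "k \<ge> 1" "a 1 = 1" "strict_mono_on {1..k} a" "h_zero a k \<le> h"
  shows "a k \<le> h_range a k h"
proof -
  have "a k \<le> h_range a k (h_zero a k)"
    using h_zero_eq_iff[OF assms(1-3)] by blast
  also have "\<dots> \<le> h_range a k h"
    using assms(3,4) by (rule h_range_mono)
  finally show ?thesis .
qed

definition h_defect :: "(nat \<Rightarrow> nat) \<Rightarrow> nat \<Rightarrow> nat \<Rightarrow> nat" where
  "h_defect a k h = h * a k - h_range a k h"

lemma h_range_add_h_defect:
  assumes "strict_mono_on {1..k} a"
  shows "h_range a k h + h_defect a k h = h * a k"
  using h_range_le[OF assms] by (simp add: h_defect_def)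

lemma h_defect_Suc_le:
  assumes "k \<ge> 1" "strict_mono_on {1..k} a" "a k \<le> Suc (h_range a k h)"
  shows "h_defect a k (Suc h) \<le> h_defect a k h"
proof -
  have "h_representation a k 1 (a k)"
    using assms(1) by (intro h_representation_basis) simp
  from h_range_add_le[OF assms(2) this assms(3)] show ?thesis
    by (simp add: h_defect_def)
qed

lemma antimono_on_h_defect:
  assumes "k \<ge> 1" "a 1 = 1" "strict_mono_on {1..k} a"
  shows "antimono_on {h_zero a k..} (h_defect a k)"
proof (rule monotone_onI)
  fix g h assume "g \<in> {h_zero a k..}" "g \<le> h"
  show "h_defect a k h \<le> h_defect a k g"
  proof (rule lift_Suc_antimono_le_ivl[OF _ \<open>g \<le> h\<close>])
    fix j assume "j \<in> {h_zero a k..}"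
    then show "h_defect a k (Suc j) \<le> h_defect a k j"
      by (intro h_defect_Suc_le[OF assms(1,3)] le_SucI h_range_ge_if_h_zero_le[OF assms]) simp
  next
    show "{g..<h} \<subseteq> {h_zero a k..}"
      using \<open>g \<in> {h_zero a k..}\<close> by auto
  qed
qed

theorem theorem2:
  fixes a :: "nat \<Rightarrow> nat" and k :: nat
  assumes "k \<ge> 1"
    and "a 1 = 1"
    and "strict_mono_on {1..k} a"
  shows "\<exists>h1 \<ge> h_zero a k - 1. \<forall>h \<ge> h1. h_range a k (h + 1) = h_range a k h + a k"
proof -
  obtain h1 where "h1 \<ge> h_zero a k"
    and h_defect_eq: "\<And>h. h \<ge> h1 \<Longrightarrow> h_defect a k h = h_defect a k h1"
    using antimono_on_atLeast_eventually_constant[OF antimono_on_h_defect[OF assms]] by blast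
  have "h_range a k (h + 1) = h_range a k h + a k" if "h \<ge> h1" for h
  proof -
    have "h_range a k (h + 1) + h_defect a k h1 = (h + 1) * a k"
      using h_range_add_h_defect[OF assms(3), of "h + 1"] h_defect_eq[of "h + 1"] that by simp
    also have "\<dots> = h_range a k h + h_defect a k h1 + a k"
      using h_range_add_h_defect[OF assms(3), of h] h_defect_eq[OF that] by simp
    finally show ?thesis
      by simp
  qed
  with \<open>h1 \<ge> h_zero a k\<close> show ?thesis
    by (intro exI[of _ h1]) simp
qed

end
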